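(* Let $H_1$ and $H_2$ be two finite simple graphs on $n$ nodes. The following statements are equivalent: (i) $H_1$ and $H_2$ are isomorphic. (ii) For all graphs $G$ (without isolated vertex) on at most $n$ nodes and having at most $\left\lfloor \frac{1}{2}\binom{n}{2}\right\rfloor$ edges, $\mathcal{P}_{n,G}(H_1)=\mathcal{P}_{n,G}(H_2)$. (iii) For all graphs $G$ (without isolated vertex) on at most $n$ nodes and having at most $\left\lfloor \frac{1}{2}\binom{n}{2}\right\rfloor$ edges, $\mathcal{M}_{G}(H_1)=\mathcal{M}_{G}(H_2)$.
   Context: Graphs are finite, undirected, without loops or multiple edges; $n$ is a positive integer. $\mathbb{K}$ is a field of characteristic $0$. Let $x_{ij}$, for integers $0<i<j$, be commuting variables; infinite formal sums of monomials are allowed. Action: for $\sigma \in \mathfrak{S}_m$ and $1\le i<j\le m$, $\sigma\cdot(i,j) := (\min(\sigma(i),\sigma(j)),\max(\sigma(i),\sigma(j)))$. Definition of $\mathcal{M}_G$: let $G$ be a graph on $m\ge 2$ vertices without isolated vertex. Choose any labeling of the vertices of $G$ by $1,\dots,m$ and let $a_{ij}\in\{0,1\}$ ($1\le i<j\le m$) be $1$ if and only if $i$ and $j$ are adjacent. Let $R\subset\mathfrak{S}_m$ be a set of permutations such that the families $(a_{\sigma\cdot(i,j)})_{1\le i<j\le m}$, $\sigma\in R$, are pairwise distinct and exhaust all the families obtained for $\sigma\in\mathfrak{S}_m$. Then $$\mathcal{M}_G := \sum_{0<r_1<\dots<r_m}\ \sum_{\sigma\in R}\ \prod_{1\le i<j\le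 m} x_{r_i r_j}^{a_{\sigma\cdot(i,j)}} .$$ By convention the one-vertex graph $\bullet$ counts as a graph without isolated vertex, and $\mathcal{M}_\bullet:=1$. $\mathcal{P}_{n,G}\in\mathbb{K}[x_{ij}\mid 1\le i<j\le n]$ is the polynomial obtained from $\mathcal{M}_G$ by setting to $0$ every variable having an index greater than $n$. Evaluation: for a graph $H$ on $n$ vertices, choose a labeling of its vertices by $1,\dots,n$, put $b_{ij}=1$ if $i<j\le n$ are adjacent in $H$ and $b_{ij}=0$ for all other pairs $i<j$ (in particular if $j>n$). $\mathcal{M}_G(H)$ and $\mathcal{P}_{n,G}(H)$ are the values obtained by substituting $x_{ij}=b_{ij}$; they do not depend on the labeling.
   Formalization: The case n = 2 is excluded, since there the edge bound is 0, only the one-vertex graph G is admissible, and a single edge is not distinguished from two isolated nodes; the graphs G are taken with natural numbers as nodes. *)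

theory Defs
  imports
    "HOL-Library.Poly_Mapping"
    "HOL-Library.FuncSet"
    "HOL-Combinatorics.Permutations"
begin

section \<open>Finite simple graphs\<close>

record 'a sgraph =
  verts :: "'a set"
  edges :: "'a set set"

definition simple_graph :: "'a sgraph \<Rightarrow> bool" where
  "simple_graph G \<longleftrightarrow>
     finite (verts G) \<and> verts G \<noteq> {} \<and> edges G \<subseteq> {e. e \<subseteq> verts G \<and> card e = 2}"

definition isomorphic :: "'a sgraph \<Rightarrow> 'b sgraph \<Rightarrow> bool" where
  "isomorphic G H \<longleftrightarrow>
     (\<exists>f. bij_betw f (verts G) (verts H) \<and>
          (\<forall>u\<in>verts G. \<forall>v\<in>verts G. {u, v} \<in> edges G \<longleftrightarrow> {f u, f v} \<in> edges H))"

text \<open>By convention the one-vertex graph counts as a graph without isolated vertex.\<close>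

definition no_isolated_vertex :: "'a sgraph \<Rightarrow> bool" where
  "no_isolated_vertex G \<longleftrightarrow> card (verts G) = 1 \<or> (\<forall>v\<in>verts G. \<exists>e\<in>edges G. v \<in> e)"

definition labeling :: "'a sgraph \<Rightarrow> (nat \<Rightarrow> 'a) \<Rightarrow> bool" where
  "labeling G l \<longleftrightarrow> bij_betw l {1..card (verts G)} (verts G)"

text \<open>
  The indicator family of the edges of a labelled graph. It serves both as the exponents
  \<open>a\<^sub>i\<^sub>j\<close> (with values in \<^typ>\<open>nat\<close>) and as the values \<open>b\<^sub>i\<^sub>j\<close> substituted for the variables
  (with values in the field), and is 0 outside \<open>1 \<le> i < j \<le> card (verts G)\<close>.
\<close>

definition adj :: "'a sgraph \<Rightarrow> (nat \<Rightarrow> 'a) \<Rightarrow> nat \<times> nat \<Rightarrow> 'c::zero_neq_one" where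
  "adj G l = (\<lambda>(i, j).
     of_bool (1 \<le> i \<and> i < j \<and> j \<le> card (verts G) \<and> {l i, l j} \<in> edges G))"

section \<open>The series and polynomials attached to a graph\<close>

text \<open>
  The variable \<open>x\<^sub>i\<^sub>j\<close> is represented by the pair \<open>(i, j)\<close>, a monomial by its finitely supported
  exponent function, a formal infinite sum of monomials by its coefficient function, and a
  polynomial by a finitely supported coefficient function.
\<close>

type_synonym monomial = "(nat \<times> nat) \<Rightarrow>\<^sub>0 nat"
type_synonym 'k series = "monomial \<Rightarrow> 'k"
type_synonym 'k polynomial = "monomial \<Rightarrow>\<^sub>0 'k"

definition pairs :: "nat \<Rightarrow> (nat \<times> nat) set" where
  "pairs m = {(i, j). 1 \<le> i \<and> i < j \<and> j \<le> m}"

definition act :: "(nat \<Rightarrow> nat) \<Rightarrow> nat \<times> nat \<Rightarrow> nat \<times> nat" where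
  "act \<sigma> = (\<lambda>(i, j). (min (\<sigma> i) (\<sigma> j), max (\<sigma> i) (\<sigma> j)))"

definition family :: "nat \<Rightarrow> (nat \<times> nat \<Rightarrow> nat) \<Rightarrow> (nat \<Rightarrow> nat) \<Rightarrow> nat \<times> nat \<Rightarrow> nat" where
  "family m a \<sigma> = restrict (\<lambda>p. a (act \<sigma> p)) (pairs m)"

definition transversal :: "nat \<Rightarrow> (nat \<times> nat \<Rightarrow> nat) \<Rightarrow> (nat \<Rightarrow> nat) set \<Rightarrow> bool" where
  "transversal m a R \<longleftrightarrow>
     R \<subseteq> {\<sigma>. \<sigma> permutes {1..m}} \<and> inj_on (family m a) R \<and>
     family m a ` R = family m a ` {\<sigma>. \<sigma> permutes {1..m}}"

text \<open>
  The index sequences \<open>0 < r\<^sub>1 < \<dots> < r\<^sub>m\<close>; extensionality makes each sequence correspond to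
  exactly one function.
\<close>

definition index_seqs :: "nat \<Rightarrow> (nat \<Rightarrow> nat) set" where
  "index_seqs m =
     {r \<in> extensional {1..m}. strict_mono_on {1..m} r \<and> (\<forall>i\<in>{1..m}. 0 < r i)}"

text \<open>The monomial \<open>\<Prod>\<^bsub>1\<le>i<j\<le>m\<^esub> x\<^bsub>r i, r j\<^esub>\<close> with exponents \<open>a (\<sigma> \<cdot> (i, j))\<close>.\<close>

definition mono_of ::
  "nat \<Rightarrow> (nat \<times> nat \<Rightarrow> nat) \<Rightarrow> (nat \<Rightarrow> nat) \<Rightarrow> (nat \<Rightarrow> nat) \<Rightarrow> monomial" where
  "mono_of m a r \<sigma> =
     (\<Sum>(i, j)\<in>pairs m. Poly_Mapping.single (r i, r j) (a (act \<sigma> (i, j))))"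

text \<open>
  The formal sum over \<open>r\<close> and \<open>\<sigma> \<in> R\<close>: the coefficient of a monomial is the number of summands
  equal to it, which is finite for graphs without isolated vertex
  (lemma \<open>finite_summands\<close> below).
\<close>

definition series_of ::
  "nat \<Rightarrow> (nat \<times> nat \<Rightarrow> nat) \<Rightarrow> (nat \<Rightarrow> nat) set \<Rightarrow> 'k::field_char_0 series" where
  "series_of m a R =
     (\<lambda>\<mu>. of_nat (card {(r, \<sigma>) \<in> index_seqs m \<times> R. mono_of m a r \<sigma> = \<mu>}))"

definition M_graph :: "'a sgraph \<Rightarrow> 'k::field_char_0 series" where
  "M_graph G =
     (if card (verts G) = 1 then (\<lambda>\<mu>. of_bool (\<mu> = 0))
      else let m = card (verts G);
               a = adj G (SOME l. labeling G l);
               R = (SOME R. transversal m a R)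
           in series_of m a R)"

text \<open>
  Setting every variable with an index greater than \<open>n\<close> to 0 kills exactly the monomials containing
  such a variable; what remains is a polynomial by lemma \<open>finite_truncation\<close> below.
\<close>

definition P_graph :: "nat \<Rightarrow> 'a sgraph \<Rightarrow> 'k::field_char_0 polynomial" where
  "P_graph n G =
     Abs_poly_mapping (\<lambda>\<mu>. if \<forall>(i, j)\<in>Poly_Mapping.keys \<mu>. i \<le> n \<and> j \<le> n then M_graph G \<mu> else 0)"

section \<open>Evaluation at a graph\<close>

definition eval_mono :: "(nat \<times> nat \<Rightarrow> 'k) \<Rightarrow> monomial \<Rightarrow> 'k::comm_semiring_1" where
  "eval_mono b \<mu> = (\<Prod>v\<in>Poly_Mapping.keys \<mu>. b v ^ Poly_Mapping.lookup \<mu> v)"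

definition eval_poly :: "(nat \<times> nat \<Rightarrow> 'k) \<Rightarrow> 'k polynomial \<Rightarrow> 'k::comm_semiring_1" where
  "eval_poly b p = (\<Sum>\<mu>\<in>Poly_Mapping.keys p. Poly_Mapping.lookup p \<mu> * eval_mono b \<mu>)"

text \<open>
  \<^const>\<open>Sum_any\<close> adds up the nonzero terms. For \<open>M_graph G\<close> and values \<open>b\<close> vanishing on all
  variables with a large index there are finitely many of them (lemma \<open>finite_eval_series\<close>
  below).
\<close>

definition eval_series :: "(nat \<times> nat \<Rightarrow> 'k) \<Rightarrow> 'k series \<Rightarrow> 'k::comm_semiring_1" where
  "eval_series b f = Sum_any (\<lambda>\<mu>. f \<mu> * eval_mono b \<mu>)"

definition M_at :: "'a sgraph \<Rightarrow> 'b sgraph \<Rightarrow> 'k::field_char_0" where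
  "M_at G H = eval_series (adj H (SOME l. labeling H l)) (M_graph G)"

definition P_at :: "nat \<Rightarrow> 'a sgraph \<Rightarrow> 'b sgraph \<Rightarrow> 'k::field_char_0" where
  "P_at n G H = eval_poly (adj H (SOME l. labeling H l)) (P_graph n G)"

section \<open>Existence of the choices and finiteness of the sums\<close>

lemma labeling_exists:
  assumes "simple_graph G"
  shows "labeling G (SOME l. labeling G l)"
proof -
  have "\<exists>l. bij_betw l {1..card (verts G)} (verts G)"
    by (rule finite_same_card_bij) (use assms in \<open>auto simp: simple_graph_def\<close>)
  then have "\<exists>l. labeling G l" by (simp add: labeling_def)
  then show ?thesis by (rule someI_ex)
qed

lemma transversal_exists: "transversal m a (SOME R. transversal m a R)"
proof -
  obtain R where R: "R \<subseteq> {\<sigma>. \<sigma> permutes {1..m}}" "inj_on (family m a) R"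
      "family m a ` {\<sigma>. \<sigma> permutes {1..m}} = family m a ` R"
    using iffD1[OF subset_image_inj subset_refl] by metis
  have "transversal m a R"
    unfolding transversal_def by (intro conjI R(1) R(2) R(3)[symmetric])
  then have "\<exists>R. transversal m a R" ..
  then show ?thesis by (rule someI_ex)
qed

lemma finite_pairs: "finite (pairs m)"
  by (rule finite_subset[of _ "{1..m} \<times> {1..m}"]) (auto simp: pairs_def)

lemma index_in_keys:
  assumes G: "simple_graph G" "no_isolated_vertex G" "card (verts G) \<noteq> 1"
    and l: "labeling G l" and m: "m = card (verts G)"
    and s: "\<sigma> permutes {1..m}" and i: "i \<in> {1..m}"
  shows "\<exists>p\<in>Poly_Mapping.keys (mono_of m (adj G l) r \<sigma>). r i = fst p \<or> r i = snd p"
proof -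
  have bij: "bij_betw l {1..m} (verts G)" using l m by (simp add: labeling_def)
  have si: "\<sigma> i \<in> {1..m}" using permutes_in_image[OF s] i by blast
  then have "l (\<sigma> i) \<in> verts G" using bij by (auto simp: bij_betw_def)
  then obtain e where e: "e \<in> edges G" "l (\<sigma> i) \<in> e"
    using G by (auto simp: no_isolated_vertex_def)
  then have e2: "card e = 2" "e \<subseteq> verts G" using G(1) by (auto simp: simple_graph_def)
  then obtain w where w: "e = {l (\<sigma> i), w}" "w \<noteq> l (\<sigma> i)"
    using e(2) by (auto simp: card_2_iff)
  then have "w \<in> l ` {1..m}" using e2 bij by (auto simp: bij_betw_def)
  then obtain j' where j': "j' \<in> {1..m}" "w = l j'" by auto
  define j where "j = inv \<sigma> j'"
  have sj: "\<sigma> j = j'" using permutes_inverses(1)[OF s] by (simp add: j_def)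
  have j: "j \<in> {1..m}" "\<sigma> j \<in> {1..m}" using permutes_in_image[OF s, of j] j'(1) sj by simp_all
  have ne: "\<sigma> i \<noteq> \<sigma> j" using w(2) j'(2) sj by metis
  then have "i \<noteq> j" by auto
  define p where "p = (min i j, max i j)"
  have p: "p \<in> pairs m" using i j \<open>i \<noteq> j\<close> by (auto simp: p_def pairs_def min_def max_def)
  have E: "{l (\<sigma> i), l (\<sigma> j)} \<in> edges G" "{l (\<sigma> j), l (\<sigma> i)} \<in> edges G"
    using e(1) w(1) j'(2) sj by (simp_all add: insert_commute)
  have "act \<sigma> p = (min (\<sigma> i) (\<sigma> j), max (\<sigma> i) (\<sigma> j))"
    by (simp add: act_def p_def min_def max_def)
  moreover have "adj G l (min (\<sigma> i) (\<sigma> j), max (\<sigma> i) (\<sigma> j)) = (1 :: nat)"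
    using E ne si j(2) m by (cases "\<sigma> i < \<sigma> j") (simp_all add: adj_def min_def max_def)
  ultimately have adj1: "adj G l (act \<sigma> p) = (1 :: nat)" by simp
  let ?v = "(r (fst p), r (snd p))"
  have "Poly_Mapping.lookup (mono_of m (adj G l) r \<sigma>) ?v =
      (\<Sum>q\<in>pairs m. Poly_Mapping.lookup (Poly_Mapping.single (r (fst q), r (snd q)) (adj G l (act \<sigma> q))) ?v)"
    unfolding mono_of_def lookup_sum by (intro sum.cong refl) (auto split: prod.splits)
  also have "\<dots> \<ge> Poly_Mapping.lookup (Poly_Mapping.single ?v (adj G l (act \<sigma> p))) ?v"
    by (rule member_le_sum[OF p _ finite_pairs]) auto
  finally have "Poly_Mapping.lookup (mono_of m (adj G l) r \<sigma>) ?v \<ge> 1" using adj1 by simp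
  then have "?v \<in> Poly_Mapping.keys (mono_of m (adj G l) r \<sigma>)" by (simp add: in_keys_iff)
  moreover have "r i = fst ?v \<or> r i = snd ?v" by (auto simp: p_def min_def max_def)
  ultimately show ?thesis by blast
qed

lemma finite_summands_bounded:
  assumes G: "simple_graph G" "no_isolated_vertex G" "card (verts G) \<noteq> 1"
    and l: "labeling G l" and m: "m = card (verts G)"
    and R: "R \<subseteq> {\<sigma>. \<sigma> permutes {1..m}}" and V: "finite V"
  shows "finite {(r, \<sigma>) \<in> index_seqs m \<times> R. Poly_Mapping.keys (mono_of m (adj G l) r \<sigma>) \<subseteq> V}"
proof (rule finite_subset)
  show "{(r, \<sigma>) \<in> index_seqs m \<times> R. Poly_Mapping.keys (mono_of m (adj G l) r \<sigma>) \<subseteq> V}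
      \<subseteq> ({1..m} \<rightarrow>\<^sub>E (fst ` V \<union> snd ` V)) \<times> {\<sigma>. \<sigma> permutes {1..m}}"
  proof (rule subrelI)
    fix r \<sigma>
    assume "(r, \<sigma>) \<in> {(r, \<sigma>) \<in> index_seqs m \<times> R. Poly_Mapping.keys (mono_of m (adj G l) r \<sigma>) \<subseteq> V}"
    then have r: "r \<in> index_seqs m" and s: "\<sigma> \<in> R" and k: "Poly_Mapping.keys (mono_of m (adj G l) r \<sigma>) \<subseteq> V"
      by auto
    have sp: "\<sigma> permutes {1..m}" using s R by auto
    have "r i \<in> fst ` V \<union> snd ` V" if i: "i \<in> {1..m}" for i
    proof -
      obtain p where p: "p \<in> V" "r i = fst p \<or> r i = snd p"
        using index_in_keys[OF G l m sp i, of r] k by blast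
      then show ?thesis by blast
    qed
    then show "(r, \<sigma>) \<in> ({1..m} \<rightarrow>\<^sub>E (fst ` V \<union> snd ` V)) \<times> {\<sigma>. \<sigma> permutes {1..m}}"
      using r sp by (auto simp: index_seqs_def PiE_def)
  qed
  show "finite (({1..m} \<rightarrow>\<^sub>E (fst ` V \<union> snd ` V)) \<times> {\<sigma>. \<sigma> permutes {1..m}})"
    using V by (auto intro!: finite_PiE finite_permutations)
qed

lemma finite_summands:
  assumes "simple_graph G" "no_isolated_vertex G" "card (verts G) \<noteq> 1"
    and "labeling G l" "m = card (verts G)" "R \<subseteq> {\<sigma>. \<sigma> permutes {1..m}}"
  shows "finite {(r, \<sigma>) \<in> index_seqs m \<times> R. mono_of m (adj G l) r \<sigma> = \<mu>}"
  by (rule finite_subset[OF _ finite_summands_bounded[OF assms, of "Poly_Mapping.keys \<mu>"]]) auto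

lemma finite_M_graph_support:
  assumes G: "simple_graph G" "no_isolated_vertex G" and V: "finite V"
  shows "finite {\<mu>. Poly_Mapping.keys \<mu> \<subseteq> V \<and> (M_graph G \<mu> :: 'k::field_char_0) \<noteq> 0}"
proof (cases "card (verts G) = 1")
  case True
  then have "{\<mu>. Poly_Mapping.keys \<mu> \<subseteq> V \<and> (M_graph G \<mu> :: 'k) \<noteq> 0} \<subseteq> {0}"
    by (auto simp: M_graph_def)
  then show ?thesis by (rule finite_subset) simp
next
  case False
  define m where "m = card (verts G)"
  define a :: "nat \<times> nat \<Rightarrow> nat" where "a = adj G (SOME l. labeling G l)"
  define R where "R = (SOME R. transversal m a R)"
  have M: "(M_graph G :: 'k series) = series_of m a R"
    using False by (simp add: M_graph_def m_def a_def R_def Let_def)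
  have R: "R \<subseteq> {\<sigma>. \<sigma> permutes {1..m}}"
    using transversal_exists[of m a] by (simp add: R_def transversal_def)
  let ?S = "{(r, \<sigma>) \<in> index_seqs m \<times> R. Poly_Mapping.keys (mono_of m a r \<sigma>) \<subseteq> V}"
  have fin: "finite ?S"
    unfolding a_def
    by (rule finite_summands_bounded[OF G False labeling_exists[OF G(1)] m_def R V])
  show ?thesis
  proof (rule finite_subset[OF _ finite_imageI[OF fin, of "\<lambda>(r, \<sigma>). mono_of m a r \<sigma>"]], rule subsetI)
    fix \<mu>
    assume "\<mu> \<in> {\<mu>. Poly_Mapping.keys \<mu> \<subseteq> V \<and> (M_graph G \<mu> :: 'k) \<noteq> 0}"
    then have k: "Poly_Mapping.keys \<mu> \<subseteq> V"
      and "card {(r, \<sigma>) \<in> index_seqs m \<times> R. mono_of m a r \<sigma> = \<mu>} \<noteq> 0"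
      by (auto simp: M series_of_def)
    then have "{(r, \<sigma>) \<in> index_seqs m \<times> R. mono_of m a r \<sigma> = \<mu>} \<noteq> {}"
      by (metis card.empty)
    then obtain r \<sigma> where rs: "r \<in> index_seqs m" "\<sigma> \<in> R" "\<mu> = mono_of m a r \<sigma>" by blast
    show "\<mu> \<in> (\<lambda>(r, \<sigma>). mono_of m a r \<sigma>) ` ?S"
      by (rule image_eqI[of _ _ "(r, \<sigma>)"]) (use rs k in simp_all)
  qed
qed

lemma finite_truncation:
  assumes "simple_graph G" "no_isolated_vertex G"
  shows "finite {\<mu>. (if \<forall>(i, j)\<in>Poly_Mapping.keys \<mu>. i \<le> n \<and> j \<le> n
                     then M_graph G \<mu> else 0 :: 'k::field_char_0) \<noteq> 0}"
  by (rule finite_subset[OF _ finite_M_graph_support[OF assms, of "{..n} \<times> {..n}", where 'k = 'k]])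
    (auto split: if_splits)

lemma lookup_P_graph:
  assumes "simple_graph G" "no_isolated_vertex G"
  shows "Poly_Mapping.lookup (P_graph n G) \<mu> =
    (if \<forall>(i, j)\<in>Poly_Mapping.keys \<mu>. i \<le> n \<and> j \<le> n then M_graph G \<mu> else (0 :: 'k::field_char_0))"
  unfolding P_graph_def
  using Abs_poly_mapping_inverse[OF CollectI, OF finite_truncation[OF assms, of n, where 'k = 'k]]
  by simp

lemma finite_eval_series:
  fixes b :: "nat \<times> nat \<Rightarrow> 'k::field_char_0"
  assumes "simple_graph G" "no_isolated_vertex G"
    and b: "\<And>i j. \<not> (i \<le> n \<and> j \<le> n) \<Longrightarrow> b (i, j) = 0"
  shows "finite {\<mu>. M_graph G \<mu> * eval_mono b \<mu> \<noteq> 0}"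
proof (rule finite_subset[OF _ finite_M_graph_support[OF assms(1,2), of "{..n} \<times> {..n}", where 'k = 'k]])
  show "{\<mu>. M_graph G \<mu> * eval_mono b \<mu> \<noteq> 0}
      \<subseteq> {\<mu>. Poly_Mapping.keys \<mu> \<subseteq> {..n} \<times> {..n} \<and> (M_graph G \<mu> :: 'k) \<noteq> 0}"
  proof clarify
    fix \<mu> assume nz: "M_graph G \<mu> * eval_mono b \<mu> \<noteq> 0"
    have "b v \<noteq> 0" if "v \<in> Poly_Mapping.keys \<mu>" for v
      using nz that by (auto simp: eval_mono_def in_keys_iff)
    then have "Poly_Mapping.keys \<mu> \<subseteq> {..n} \<times> {..n}"
      using b by (meson atMost_iff mem_Sigma_iff subrelI)
    then show "Poly_Mapping.keys \<mu> \<subseteq> {..n} \<times> {..n} \<and> (M_graph G \<mu> :: 'k) \<noteq> 0" using nz by auto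
  qed
qed simp

section \<open>The case of two vertices\<close>

text \<open>
  For \<open>n = 2\<close> the bound \<open>\<lfloor>(n choose 2) / 2\<rfloor>\<close> is 0, so the one-vertex graph is the only admissible
  \<open>G\<close>, and the edge \<open>K\<^sub>2\<close> is not distinguished from two isolated vertices. This is why the theorem
  assumes \<open>n \<noteq> 2\<close>.
\<close>

lemma M_at_one_vertex:
  assumes "card (verts G) = 1"
  shows "(M_at G H :: 'k::field_char_0) = 1"
proof -
  have "Sum_any (\<lambda>\<mu>. M_graph G \<mu> * eval_mono b \<mu>) = (1 :: 'k)" for b
  proof -
    have *: "M_graph G \<mu> * eval_mono b \<mu> = (1 when \<mu> = 0 :: 'k)" for \<mu>
      using assms by (simp add: M_graph_def eval_mono_def when_def)
    show ?thesis unfolding * by simp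
  qed
  then show ?thesis by (simp add: M_at_def eval_series_def)
qed

lemma P_at_one_vertex:
  assumes "simple_graph G" "card (verts G) = 1"
  shows "(P_at n G H :: 'k::field_char_0) = 1"
proof -
  have G: "no_isolated_vertex G" using assms(2) by (simp add: no_isolated_vertex_def)
  have "P_graph n G = (Poly_Mapping.single 0 1 :: 'k polynomial)"
    by (rule poly_mapping_eqI)
      (simp add: lookup_P_graph[OF assms(1) G] M_graph_def assms(2) lookup_one when_def)
  then show ?thesis by (simp add: P_at_def eval_poly_def eval_mono_def)
qed

lemma not_distinguished_two_vertices:
  fixes G :: "'a sgraph"
  defines "H1 \<equiv> \<lparr>verts = {1, 2 :: nat}, edges = {{1, 2}}\<rparr>"
    and "H2 \<equiv> \<lparr>verts = {1, 2 :: nat}, edges = {}\<rparr>"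
  shows "simple_graph H1 \<and> card (verts H1) = 2 \<and> simple_graph H2 \<and> card (verts H2) = 2"
    and "\<not> isomorphic H1 H2"
    and "simple_graph G \<Longrightarrow> no_isolated_vertex G \<Longrightarrow> card (edges G) \<le> (2 choose 2) div 2 \<Longrightarrow>
      (P_at 2 G H1 :: 'k::field_char_0) = P_at 2 G H2 \<and>
      (M_at G H1 :: 'k) = M_at G H2"
proof -
  show "simple_graph H1 \<and> card (verts H1) = 2 \<and> simple_graph H2 \<and> card (verts H2) = 2"
    by (auto simp: H1_def H2_def simple_graph_def)
  show "\<not> isomorphic H1 H2"
    by (auto simp: H1_def H2_def isomorphic_def)
  assume G: "simple_graph G" "no_isolated_vertex G" "card (edges G) \<le> (2 choose 2) div 2"
  have "finite (edges G)"
    by (rule finite_subset[of _ "Pow (verts G)"]) (use G(1) in \<open>auto simp: simple_graph_def\<close>)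
  then have "edges G = {}" using G(3) by simp
  then have "card (verts G) = 1" using G(1,2) by (auto simp: no_isolated_vertex_def simple_graph_def)
  then show "(P_at 2 G H1 :: 'k) = P_at 2 G H2 \<and> (M_at G H1 :: 'k) = M_at G H2"
    by (simp add: P_at_one_vertex[OF G(1)] M_at_one_vertex)
qed

end

(*
  For a graph G without isolated vertex, M_G(H) is the number of subgraphs of H isomorphic to G.
  For edge sets A and B on the common vertex set V, let N(A, B) be the number of permutations of V
  mapping A into the edges of H and B into the non-edges of H. Then N(A, {}) is the number of
  subgraphs of H isomorphic to A times the order of the stabilizer of A, and
  N(A, B + e) = N(A, B) - N(A + e, B). Hence the small subgraph counts determine N(A, B) as long as
  A and B together have at most half of all pairs. One of H1 and its complement is that small, so
  comparing the counts for (H1, {}) or for ({}, complement of H1) yields a permutation carrying H1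
  to H2, as the two graphs have equally many edges.
*)

theory Submission
  imports Defs "HOL-Library.Infinite_Set"
begin

section \<open>Copies of a graph, and invariance of their number under isomorphism\<close>

section \<open>Subgraph counts\<close>

text \<open>A copy is recorded by its edge set alone, which determines its vertices when none is
  isolated. The codomain of \<open>g\<close> is left open, so for the one-vertex graph the empty set
  is the single copy, in accordance with the value 1 of its series.\<close>

definition copies :: "'a sgraph \<Rightarrow> 'b sgraph \<Rightarrow> 'b set set set" where
  "copies G H = {S. S \<subseteq> edges H \<and> (\<exists>g. inj_on g (verts G) \<and> S = (`) g ` edges G)}"

lemma simple_graph_finite_edges: "simple_graph G \<Longrightarrow> finite (edges G)"
  by (rule finite_subset[of _ "Pow (verts G)"]) (auto simp: simple_graph_def)

lemma simple_graph_edgeE: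
  assumes "simple_graph G" "e \<in> edges G"
  obtains u v where "e = {u, v}" "u \<noteq> v" "u \<in> verts G" "v \<in> verts G"
proof -
  have "card e = 2" "e \<subseteq> verts G" using assms by (auto simp: simple_graph_def)
  then show thesis using that by (auto simp: card_2_iff)
qed

lemma simple_graph_one_vertex:
  assumes "simple_graph G" "card (verts G) = 1"
  shows "edges G = {}"
proof -
  obtain x where x: "verts G = {x}" using assms(2) by (rule card_1_singletonE)
  show ?thesis
  proof (rule ccontr)
    assume "edges G \<noteq> {}"
    then obtain e where "e \<in> edges G" by blast
    then show False using simple_graph_edgeE[OF assms(1)] x by (metis singletonD)
  qed
qed

text \<open>Edges are two-element sets of vertices, and an injection on vertices is injective on
  such sets, so adjacency can be pushed forward and pulled back. Counting arguments use isomorphisms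
  in this form.\<close>

lemma isomorphic_iff_image:
  assumes "simple_graph G" "simple_graph H"
  shows "isomorphic G H \<longleftrightarrow> (\<exists>f. bij_betw f (verts G) (verts H) \<and> (`) f ` edges G = edges H)"
proof
  assume "isomorphic G H"
  then obtain f where f: "bij_betw f (verts G) (verts H)"
    and e: "\<And>u v. u \<in> verts G \<Longrightarrow> v \<in> verts G \<Longrightarrow> {u, v} \<in> edges G \<longleftrightarrow> {f u, f v} \<in> edges H"
    by (auto simp: isomorphic_def)
  have "(`) f ` edges G = edges H"
  proof (intro equalityI subsetI)
    fix x assume "x \<in> (`) f ` edges G"
    then obtain y where y: "y \<in> edges G" "x = f ` y" by blast
    then show "x \<in> edges H"
      using simple_graph_edgeE[OF assms(1) y(1)] e by (metis image_insert image_empty)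
  next
    fix x assume x: "x \<in> edges H"
    obtain u v where uv: "x = {u, v}" "u \<in> verts H" "v \<in> verts H"
      using simple_graph_edgeE[OF assms(2) x] by metis
    then obtain u' v' where "u' \<in> verts G" "v' \<in> verts G" "u = f u'" "v = f v'"
      using f unfolding bij_betw_def by blast
    then have "{u', v'} \<in> edges G" "x = f ` {u', v'}" using e x uv by auto
    then show "x \<in> (`) f ` edges G" by blast
  qed
  with f show "\<exists>f. bij_betw f (verts G) (verts H) \<and> (`) f ` edges G = edges H" by blast
next
  assume "\<exists>f. bij_betw f (verts G) (verts H) \<and> (`) f ` edges G = edges H"
  then obtain f where f: "bij_betw f (verts G) (verts H)" "(`) f ` edges G = edges H" by blast
  have "{u, v} \<in> edges G \<longleftrightarrow> {f u, f v} \<in> edges H" if uv: "u \<in> verts G" "v \<in> verts G" for u v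
  proof
    assume "{u, v} \<in> edges G"
    then have "f ` {u, v} \<in> (`) f ` edges G" by blast
    then show "{f u, f v} \<in> edges H" using f(2) by simp
  next
    assume "{f u, f v} \<in> edges H"
    then have "f ` {u, v} \<in> (`) f ` edges G" using f(2) by simp
    then obtain y where y: "y \<in> edges G" "f ` {u, v} = f ` y" by blast
    moreover have "y \<subseteq> verts G" using y(1) assms(1) by (auto simp: simple_graph_def)
    ultimately have "{u, v} = y"
      using inj_on_image_eq_iff[of f "verts G" "{u, v}" y] f(1) uv by (auto simp: bij_betw_def)
    then show "{u, v} \<in> edges G" using y by simp
  qed
  then show "isomorphic G H" using f(1) by (auto simp: isomorphic_def)
qed

lemma isomorphic_sym:
  assumes "isomorphic G H" shows "isomorphic H G"
proof -
  obtain f where f: "bij_betw f (verts G) (verts H)"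
    and e: "\<forall>u\<in>verts G. \<forall>v\<in>verts G. {u, v} \<in> edges G \<longleftrightarrow> {f u, f v} \<in> edges H"
    using assms by (auto simp: isomorphic_def)
  let ?g = "inv_into (verts G) f"
  have "bij_betw ?g (verts H) (verts G)" using f by (rule bij_betw_inv_into)
  moreover have "?g u \<in> verts G" "f (?g u) = u" if "u \<in> verts H" for u
    using f that by (auto simp: bij_betw_def inv_into_into f_inv_into_f)
  ultimately show ?thesis
    using e unfolding isomorphic_def by (intro exI[of _ ?g]) simp
qed

lemma isomorphic_trans:
  assumes "isomorphic G H" "isomorphic H K" shows "isomorphic G K"
proof -
  obtain f g where f: "bij_betw f (verts G) (verts H)"
    "\<forall>u\<in>verts G. \<forall>v\<in>verts G. {u, v} \<in> edges G \<longleftrightarrow> {f u, f v} \<in> edges H"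
    and g: "bij_betw g (verts H) (verts K)"
    "\<forall>u\<in>verts H. \<forall>v\<in>verts H. {u, v} \<in> edges H \<longleftrightarrow> {g u, g v} \<in> edges K"
    using assms by (auto simp: isomorphic_def)
  have "bij_betw (g \<circ> f) (verts G) (verts K)" using f(1) g(1) by (rule bij_betw_trans)
  moreover have "f u \<in> verts H" if "u \<in> verts G" for u
    using f(1) that by (auto simp: bij_betw_def)
  ultimately show ?thesis
    using f(2) g(2) unfolding isomorphic_def by (intro exI[of _ "g \<circ> f"]) simp
qed

lemma finite_copies: "simple_graph H \<Longrightarrow> finite (copies G H)"
  by (rule finite_subset[of _ "Pow (edges H)"]) (auto simp: copies_def simple_graph_finite_edges)

text \<open>Every vertex of \<open>G\<close> lies on an edge, and the image of that edge is an edge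
  of \<open>H\<close>. This supplies the codomain that \<open>copies\<close> leaves open.\<close>

lemma copies_image_verts:
  assumes "simple_graph H" "no_isolated_vertex G" "card (verts G) \<noteq> 1"
    and "(`) g ` edges G \<subseteq> edges H"
  shows "g ` verts G \<subseteq> verts H"
proof
  fix x assume "x \<in> g ` verts G"
  then obtain v e where "x = g v" "e \<in> edges G" "v \<in> e"
    using assms(2,3) by (auto simp: no_isolated_vertex_def)
  then have "x \<in> g ` e" "g ` e \<in> edges H" using assms(4) by auto
  then show "x \<in> verts H" using assms(1) by (auto simp: simple_graph_def)
qed

text \<open>An isomorphism carries copies in \<open>H\<close> injectively to copies in
  \<open>K\<close>. One inequality suffices, since the inverse isomorphism gives the other.\<close>

lemma card_copies_mono:
  assumes "simple_graph G" "no_isolated_vertex G" "simple_graph H" "simple_graph K" "isomorphic H K"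
  shows "card (copies G H) \<le> card (copies G K)"
proof -
  obtain f where f: "bij_betw f (verts H) (verts K)" "(`) f ` edges H = edges K"
    using assms isomorphic_iff_image by blast
  have inj: "inj_on ((`) f) (edges H)"
  proof (rule inj_on_subset[OF inj_on_image_Pow])
    show "inj_on f (verts H)" using f by (simp add: bij_betw_def)
    show "edges H \<subseteq> Pow (verts H)" using assms(3) by (auto simp: simple_graph_def)
  qed
  have "inj_on ((`) ((`) f)) (copies G H)"
    by (rule inj_on_subset[OF inj_on_image_Pow[OF inj]]) (auto simp: copies_def)
  moreover have "(`) ((`) f) ` copies G H \<subseteq> copies G K"
  proof (rule image_subsetI)
    fix S assume "S \<in> copies G H"
    then obtain g where S: "S \<subseteq> edges H" and g: "inj_on g (verts G)" "S = (`) g ` edges G"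
      by (auto simp: copies_def)
    have S': "(`) f ` S \<subseteq> edges K" using S f by blast
    show "(`) f ` S \<in> copies G K"
    proof (cases "card (verts G) = 1")
      \<comment> \<open>\<open>copies_image_verts\<close> does not cover this case, but the copy is
        the empty edge set, so its image is again the empty copy.\<close>
      case True
      then have "edges G = {}" by (rule simple_graph_one_vertex[OF assms(1)])
      moreover obtain x where "verts G = {x}" using True by (rule card_1_singletonE)
      ultimately show ?thesis using g by (simp add: copies_def)
    next
      case False
      have "g ` verts G \<subseteq> verts H"
        using copies_image_verts[OF assms(3,2) False] S g(2) by simp
      then have "inj_on (f \<circ> g) (verts G)"
        using g f by (meson bij_betw_def comp_inj_on inj_on_subset)
      moreover have "(`) f ` S = (`) (f \<circ> g) ` edges G"
        unfolding g(2) by (simp add: image_image image_comp)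
      ultimately show ?thesis using S' by (auto simp: copies_def)
    qed
  qed
  ultimately show ?thesis using finite_copies[OF assms(4)] by (metis card_image card_mono)
qed

lemma card_copies_isomorphic:
  assumes "simple_graph G" "no_isolated_vertex G" "simple_graph H" "simple_graph K" "isomorphic H K"
  shows "card (copies G H) = card (copies G K)"
  using card_copies_mono[OF assms] card_copies_mono[OF assms(1,2,4,3) isomorphic_sym[OF assms(5)]]
  by simp

section \<open>Evaluation counts subgraphs\<close>

text \<open>The position of a term is its rank among the values, so an increasing sequence can be
  recovered from its set of values.\<close>

lemma strict_mono_on_card_below:
  fixes r :: "nat \<Rightarrow> nat"
  assumes r: "strict_mono_on {1..m} r" and i: "i \<in> {1..m}"
  shows "card {x \<in> r ` {1..m}. x \<le> r i} = i"
proof -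
  have "{x \<in> r ` {1..m}. x \<le> r i} = r ` {1..i}"
    using i strict_mono_on_less_eq[OF r] by auto
  moreover have "inj_on r {1..i}"
    using strict_mono_on_imp_inj_on[OF r] i by (auto intro: inj_on_subset)
  ultimately show ?thesis by (simp add: card_image)
qed

text \<open>If the terms at \<open>i\<close> differed, the larger would have the larger rank in the
  common set of values, yet both ranks equal \<open>i\<close>.\<close>

lemma strict_mono_on_eqI:
  fixes r r' :: "nat \<Rightarrow> nat"
  assumes "strict_mono_on {1..m} r" "strict_mono_on {1..m} r'"
    and img: "r ` {1..m} = r' ` {1..m}" and i: "i \<in> {1..m}"
  shows "r i = r' i"
proof -
  have *: False if "strict_mono_on {1..m} s" "strict_mono_on {1..m} s'" "s ` {1..m} = s' ` {1..m}"
    "s i < s' i" for s s' :: "nat \<Rightarrow> nat"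
  proof -
    have "s' i \<in> s ` {1..m}" using i that(3) by blast
    then have "{x \<in> s ` {1..m}. x \<le> s i} \<subset> {x \<in> s ` {1..m}. x \<le> s' i}"
      using that(4) by (intro psubsetI subsetI) (auto simp: set_eq_iff intro: exI[of _ "s' i"])
    then have "card {x \<in> s ` {1..m}. x \<le> s i} < card {x \<in> s ` {1..m}. x \<le> s' i}"
      by (rule psubset_card_mono[rotated]) simp
    then show False
      using strict_mono_on_card_below[OF that(1) i] strict_mono_on_card_below[OF that(2) i] that(3)
      by simp
  qed
  show ?thesis using *[OF assms(1,2) img] *[OF assms(2,1) img[symmetric]] by (meson linorder_neqE_nat)
qed

lemma index_seqs_exists:
  assumes Q: "finite Q" "card Q = m" "0 \<notin> Q"
  obtains r where "r \<in> index_seqs m" "r ` {1..m} = Q"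
proof -
  obtain h where h: "bij_betw h {..<m} Q" "strict_mono_on {..<m} h"
    using ex_bij_betw_strict_mono_card[OF Q(1)] Q(2) by metis
  \<comment> \<open>The enumeration \<open>h\<close> starts at index 0, an index sequence at index
    1; \<open>restrict\<close> makes the sequence extensional.\<close>
  define r where "r = restrict (\<lambda>i. h (i - 1)) {1..m}"
  have "r ` {1..m} = h ` ((\<lambda>i. i - 1) ` {1..m})" by (auto simp: r_def image_image)
  also have "(\<lambda>i. i - 1) ` {1..m} = {..<m}"
  proof (intro equalityI subsetI)
    fix x assume "x \<in> {..<m}"
    then show "x \<in> (\<lambda>i. i - 1) ` {1..m}" by (intro image_eqI[of _ _ "Suc x"]) auto
  qed auto
  finally have img: "r ` {1..m} = Q" using h(1) by (simp add: bij_betw_def)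
  have "strict_mono_on {1..m} r"
    unfolding strict_mono_on_def
  proof (intro ballI allI impI)
    fix i j assume "i \<in> {1..m} \<and> j \<in> {1..m} \<and> i < j"
    moreover then have "h (i - 1) < h (j - 1)"
      by (intro strict_mono_onD[OF h(2)]) auto
    ultimately show "r i < r j" by (simp add: r_def)
  qed
  moreover have "0 < r i" if "i \<in> {1..m}" for i
    using img that Q(3) by (metis gr0I image_eqI)
  ultimately have "r \<in> index_seqs m" by (auto simp: index_seqs_def r_def)
  then show thesis using img that by blast
qed

section \<open>Supports of monomials and evaluation at values 0 and 1\<close>

text \<open>Exponents are natural numbers, so nothing cancels: the support of the sum is the union
  of the supports of its terms.\<close>

lemma keys_mono_of:
  "Poly_Mapping.keys (mono_of m a r \<sigma>) =
    {(r i, r j) |i j. (i, j) \<in> pairs m \<and> a (act \<sigma> (i, j)) \<noteq> 0}"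
proof -
  have "Poly_Mapping.lookup (mono_of m a r \<sigma>) v =
      (\<Sum>q\<in>pairs m. Poly_Mapping.lookup (Poly_Mapping.single (r (fst q), r (snd q)) (a (act \<sigma> q))) v)" for v
    unfolding mono_of_def lookup_sum by (intro sum.cong refl) (auto split: prod.splits)
  then have "v \<in> Poly_Mapping.keys (mono_of m a r \<sigma>) \<longleftrightarrow>
      (\<exists>q\<in>pairs m. (r (fst q), r (snd q)) = v \<and> a (act \<sigma> q) \<noteq> 0)" for v
    by (auto simp: in_keys_iff finite_pairs lookup_single when_def)
  then have "Poly_Mapping.keys (mono_of m a r \<sigma>) =
      {v. \<exists>q\<in>pairs m. (r (fst q), r (snd q)) = v \<and> a (act \<sigma> q) \<noteq> 0}" by blast
  then show ?thesis by (simp only: Bex_def split_paired_Ex fst_conv snd_conv) blast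
qed

text \<open>Exponents are positive on the support, so a single variable with value 0 annihilates the
  monomial.\<close>

lemma eval_mono_of_bool:
  "eval_mono (\<lambda>p. of_bool (P p)) \<mu> = (of_bool (\<forall>p\<in>Poly_Mapping.keys \<mu>. P p) :: 'k::comm_semiring_1)"
proof (cases "\<forall>p\<in>Poly_Mapping.keys \<mu>. P p")
  case True
  then show ?thesis by (simp add: eval_mono_def)
next
  case False
  then obtain p where "p \<in> Poly_Mapping.keys \<mu>" "\<not> P p" by blast
  then have "eval_mono (\<lambda>p. of_bool (P p)) \<mu> = (0 :: 'k)"
    unfolding eval_mono_def
    by (intro prod_zero bexI[of _ p]) (auto simp: in_keys_iff zero_power)
  then show ?thesis using False by (simp del: of_bool_eq(2))
qed

text \<open>Rewrites the field-valued indicator into the form with an explicit predicate that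
  \<open>eval_series_of\<close> expects.\<close>

lemma adj_of_bool: "(adj G l :: nat \<times> nat \<Rightarrow> 'c::zero_neq_one) =
    (\<lambda>p. of_bool (adj G l p = (1 :: nat)))"
  by (auto simp: adj_def fun_eq_iff)

text \<open>Each pair of a sequence and a permutation contributes the value 0 or 1 of its monomial.
  Grouping the pairs by monomial gives the coefficients of the series, so the sum counts the pairs
  contributing 1.\<close>

lemma eval_series_of:
  fixes P :: "nat \<times> nat \<Rightarrow> bool"
  assumes fin: "finite {(r, \<sigma>) \<in> index_seqs m \<times> R. \<forall>p\<in>Poly_Mapping.keys (mono_of m a r \<sigma>). P p}"
  shows "eval_series (\<lambda>p. of_bool (P p)) (series_of m a R :: 'k::field_char_0 series) =
    of_nat (card {(r, \<sigma>) \<in> index_seqs m \<times> R. \<forall>p\<in>Poly_Mapping.keys (mono_of m a r \<sigma>). P p})"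
proof -
  let ?X = "{(r, \<sigma>) \<in> index_seqs m \<times> R. \<forall>p\<in>Poly_Mapping.keys (mono_of m a r \<sigma>). P p}"
  let ?f = "\<lambda>\<mu>. series_of m a R \<mu> * eval_mono (\<lambda>p. of_bool (P p)) \<mu> :: 'k"
  let ?mo = "\<lambda>(r, \<sigma>). mono_of m a r \<sigma>"
  have f: "?f \<mu> = of_nat (card {x \<in> ?X. ?mo x = \<mu>})" for \<mu>
  proof (cases "\<forall>p\<in>Poly_Mapping.keys \<mu>. P p")
    case True
    then have "{x \<in> ?X. ?mo x = \<mu>} = {(r, \<sigma>) \<in> index_seqs m \<times> R. mono_of m a r \<sigma> = \<mu>}"
      by auto
    then show ?thesis using True by (simp add: series_of_def eval_mono_of_bool)
  next
    case False
    then have "{x \<in> ?X. ?mo x = \<mu>} = {}" by auto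
    then show ?thesis using False by (simp only: eval_mono_of_bool) simp
  qed
  have "Sum_any ?f = (\<Sum>\<mu>\<in>?mo ` ?X. ?f \<mu>)"
  proof (rule Sum_any.expand_superset)
    show "finite (?mo ` ?X)" using fin by simp
    show "{\<mu>. ?f \<mu> \<noteq> 0} \<subseteq> ?mo ` ?X"
    proof
      fix \<mu> assume "\<mu> \<in> {\<mu>. ?f \<mu> \<noteq> 0}"
      then have "{x \<in> ?X. ?mo x = \<mu>} \<noteq> {}" unfolding f by (metis (mono_tags, lifting) card.empty mem_Collect_eq of_nat_0)
      then show "\<mu> \<in> ?mo ` ?X" by blast
    qed
  qed
  \<comment> \<open>The factor 1 gives the sum the shape of \<open>sum_fun_comp\<close>, which adds
    up the fibers of \<open>?mo\<close>.\<close>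
  also have "\<dots> = of_nat (\<Sum>\<mu>\<in>?mo ` ?X. card {x \<in> ?X. ?mo x = \<mu>} * 1)" by (simp add: f)
  also have "(\<Sum>\<mu>\<in>?mo ` ?X. card {x \<in> ?X. ?mo x = \<mu>} * 1) = card ?X"
    using sum_fun_comp[where g = ?mo and f = "\<lambda>_. 1 :: nat" and S = ?X and R = "?mo ` ?X"] fin
    by simp
  finally show ?thesis by (simp add: eval_series_def)
qed

text \<open>The monomials removed by truncation contain a variable with an index above
  \<open>n\<close>; at a graph on \<open>n\<close> vertices this variable has value 0.\<close>

lemma P_at_eq_M_at:
  assumes G: "simple_graph G" "no_isolated_vertex G" and n: "card (verts H) = n"
  shows "(P_at n G H :: 'k::field_char_0) = M_at G H"
proof -
  let ?b = "adj H (SOME l. labeling H l) :: nat \<times> nat \<Rightarrow> 'k"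
  have b0: "?b (i, j) = 0" if "\<not> (i \<le> n \<and> j \<le> n)" for i j
    using that n by (auto simp: adj_def)
  have *: "M_graph G \<mu> * eval_mono ?b \<mu> = Poly_Mapping.lookup (P_graph n G) \<mu> * eval_mono ?b \<mu>" for \<mu>
  proof (cases "\<forall>(i, j)\<in>Poly_Mapping.keys \<mu>. i \<le> n \<and> j \<le> n")
    case False
    then obtain i j where p: "(i, j) \<in> Poly_Mapping.keys \<mu>" "\<not> (i \<le> n \<and> j \<le> n)" by blast
    have "eval_mono ?b \<mu> = 0"
      unfolding eval_mono_def
      by (intro prod_zero bexI[of _ "(i, j)"]) (use p b0[OF p(2)] in \<open>auto simp: in_keys_iff zero_power\<close>)
    then show ?thesis by simp
  qed (simp add: lookup_P_graph[OF G])
  have "M_at G H = Sum_any (\<lambda>\<mu>. Poly_Mapping.lookup (P_graph n G) \<mu> * eval_mono ?b \<mu>)"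
    by (simp add: M_at_def eval_series_def *)
  also have "\<dots> = P_at n G H"
    unfolding P_at_def eval_poly_def
    by (rule Sum_any.expand_superset) (auto simp: in_keys_iff)
  finally show ?thesis by simp
qed

section \<open>The value of the series as a number of copies\<close>

lemma edges_eq_pairs:
  assumes "simple_graph G" "bij_betw k {1..m} (verts G)"
  shows "edges G = {{k i, k j} |i j. (i, j) \<in> pairs m \<and> {k i, k j} \<in> edges G}"
proof (intro equalityI subsetI)
  fix e assume e: "e \<in> edges G"
  obtain u v where uv: "e = {u, v}" "u \<noteq> v" "u \<in> verts G" "v \<in> verts G"
    using simple_graph_edgeE[OF assms(1) e] by metis
  then obtain i j where ij: "i \<in> {1..m}" "j \<in> {1..m}" "u = k i" "v = k j"
    using assms(2) unfolding bij_betw_def by blast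
  then have "i < j \<or> j < i" using uv(2) by (metis linorder_neqE_nat)
  then show "e \<in> {{k i, k j} |i j. (i, j) \<in> pairs m \<and> {k i, k j} \<in> edges G}"
  proof
    assume "i < j"
    then show ?thesis using ij uv(1) e by (auto simp: pairs_def)
  next
    assume "j < i"
    then have "(j, i) \<in> pairs m" "e = {k j, k i}" using ij uv(1) by (auto simp: pairs_def)
    then show ?thesis using e by blast
  qed
qed auto

text \<open>The action sorts the two images by \<open>min\<close> and \<open>max\<close>; as edges
  are unordered, sorting does not affect adjacency.\<close>

lemma adj_act:
  assumes l: "labeling G l" and s: "\<sigma> permutes {1..card (verts G)}"
    and ij: "(i, j) \<in> pairs (card (verts G))"
  shows "adj G l (act \<sigma> (i, j)) = (of_bool ({l (\<sigma> i), l (\<sigma> j)} \<in> edges G) :: nat)"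
proof -
  have "\<sigma> i \<in> {1..card (verts G)}" "\<sigma> j \<in> {1..card (verts G)}"
    using ij by (simp_all only: permutes_in_image[OF s]) (auto simp: pairs_def)
  moreover have "\<sigma> i \<noteq> \<sigma> j" using ij permutes_inj[OF s] by (auto simp: pairs_def dest: injD)
  ultimately show ?thesis
    by (cases "\<sigma> i < \<sigma> j") (auto simp: adj_def act_def insert_commute min_def max_def)
qed

text \<open>The summands with value 1 at \<open>H\<close> correspond bijectively to copies: the
  sequence \<open>r\<close> lists the labels of the vertices of the copy, and the class of
  \<open>\<sigma>\<close> says how \<open>G\<close> lies on them. The transversal counts each class
  once.\<close>

lemma M_at_eq_card_copies:
  assumes G: "simple_graph G" "no_isolated_vertex G" and H: "simple_graph H"
  shows "(M_at G H :: 'k::field_char_0) = of_nat (card (copies G H))"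
proof (cases "card (verts G) = 1")
  case True
  then obtain x where "verts G = {x}" by (rule card_1_singletonE)
  then have "copies G H = {{}}"
    using simple_graph_one_vertex[OF G(1) True] by (auto simp: copies_def)
  then show ?thesis by (simp add: M_at_one_vertex[OF True])
next
  case False
  define m where "m = card (verts G)"
  define n where "n = card (verts H)"
  define l where "l = (SOME l. labeling G l)"
  define h where "h = (SOME l. labeling H l)"
  define a where "a = (adj G l :: nat \<times> nat \<Rightarrow> nat)"
  define R where "R = (SOME R. transversal m a R)"
  define X where "X = {(r, \<sigma>) \<in> index_seqs m \<times> R.
    \<forall>p\<in>Poly_Mapping.keys (mono_of m a r \<sigma>). adj H h p = (1 :: nat)}"
  \<comment> \<open>The support of a monomial, read through the labeling \<open>h\<close> as a set
    of edges.\<close>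
  define \<Phi> where "\<Phi> = (\<lambda>(r, \<sigma>). (\<lambda>(i, j). {h i, h j}) ` Poly_Mapping.keys (mono_of m a r \<sigma>))"
  have lab: "labeling G l" "labeling H h"
    unfolding l_def h_def by (rule labeling_exists[OF G(1)], rule labeling_exists[OF H])
  then have l: "bij_betw l {1..m} (verts G)" and h: "bij_betw h {1..n} (verts H)"
    by (simp_all add: labeling_def m_def n_def)
  have R: "transversal m a R" unfolding R_def by (rule transversal_exists)
  have Rperm: "\<sigma> permutes {1..m}" if "\<sigma> \<in> R" for \<sigma>
    using R that by (auto simp: transversal_def)
  have adjH: "adj H h (x, y) = (1 :: nat) \<longleftrightarrow> (x, y) \<in> pairs n \<and> {h x, h y} \<in> edges H" for x y
    by (auto simp: adj_def n_def pairs_def)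
  have a: "a (act \<sigma> (i, j)) = of_bool ({l (\<sigma> i), l (\<sigma> j)} \<in> edges G)"
    if "\<sigma> permutes {1..m}" "(i, j) \<in> pairs m" for \<sigma> i j
    unfolding a_def by (rule adj_act[OF lab(1)]) (use that in \<open>simp_all add: m_def\<close>)
  have keys: "Poly_Mapping.keys (mono_of m a r \<sigma>) =
      {(r i, r j) |i j. (i, j) \<in> pairs m \<and> {l (\<sigma> i), l (\<sigma> j)} \<in> edges G}"
    if "\<sigma> permutes {1..m}" for r \<sigma>
    unfolding keys_mono_of by (intro Collect_cong ex_cong1 conj_cong refl) (simp add: a[OF that])
  \<comment> \<open>Absence of isolated vertices enters here: every index occurs in some variable,
    so the support determines the values of \<open>r\<close>.\<close>
  have range: "r ` {1..m} = fst ` Poly_Mapping.keys (mono_of m a r \<sigma>) \<union>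
      snd ` Poly_Mapping.keys (mono_of m a r \<sigma>)" if s: "\<sigma> permutes {1..m}" for r \<sigma>
  proof (intro equalityI subsetI)
    fix x assume "x \<in> r ` {1..m}"
    then obtain i where "i \<in> {1..m}" "x = r i" by blast
    with index_in_keys[OF G False lab(1) m_def s, of i r]
    show "x \<in> fst ` Poly_Mapping.keys (mono_of m a r \<sigma>) \<union>
      snd ` Poly_Mapping.keys (mono_of m a r \<sigma>)" unfolding a_def by blast
  next
    fix x assume "x \<in> fst ` Poly_Mapping.keys (mono_of m a r \<sigma>) \<union>
      snd ` Poly_Mapping.keys (mono_of m a r \<sigma>)"
    then show "x \<in> r ` {1..m}" unfolding keys[OF s] by (auto simp: pairs_def)
  qed
  \<comment> \<open>Any \<open>g\<close> sending the vertex \<open>l (\<sigma> i)\<close> to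
    \<open>h (r i)\<close> realizes this edge set as an image of \<open>edges G\<close>.\<close>
  have \<Phi>: "\<Phi> (r, \<sigma>) = (`) g ` edges G"
    if s: "\<sigma> permutes {1..m}" and g: "\<And>i. i \<in> {1..m} \<Longrightarrow> g (l (\<sigma> i)) = h (r i)" for r \<sigma> g
  proof -
    have k: "bij_betw (l \<circ> \<sigma>) {1..m} (verts G)"
      using permutes_imp_bij[OF s] l by (rule bij_betw_trans)
    have gh: "g (l (\<sigma> i)) = h (r i) \<and> g (l (\<sigma> j)) = h (r j)" if "(i, j) \<in> pairs m" for i j
      using that by (auto simp: pairs_def intro!: g)
    from edges_eq_pairs[OF G(1) k]
    have "(`) g ` edges G = (`) g ` {{l (\<sigma> i), l (\<sigma> j)} |i j.
        (i, j) \<in> pairs m \<and> {l (\<sigma> i), l (\<sigma> j)} \<in> edges G}" by simp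
    also have "\<dots> = {{g (l (\<sigma> i)), g (l (\<sigma> j))} |i j.
        (i, j) \<in> pairs m \<and> {l (\<sigma> i), l (\<sigma> j)} \<in> edges G}" by (simp add: setcompr_eq_image image_image) blast
    also have "\<dots> = {{h (r i), h (r j)} |i j.
        (i, j) \<in> pairs m \<and> {l (\<sigma> i), l (\<sigma> j)} \<in> edges G}"
      by (intro Collect_cong ex_cong1) (use gh in auto)
    also have "\<dots> = \<Phi> (r, \<sigma>)" unfolding \<Phi>_def by (simp add: keys[OF s]) blast
    finally show ?thesis by simp
  qed
  have XD: "r \<in> index_seqs m" "\<sigma> \<in> R" "\<sigma> permutes {1..m}"
    "Poly_Mapping.keys (mono_of m a r \<sigma>) \<subseteq> pairs n" "\<Phi> (r, \<sigma>) \<subseteq> edges H"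
    if "(r, \<sigma>) \<in> X" for r \<sigma>
    using that adjH Rperm[of \<sigma>] by (auto simp: X_def \<Phi>_def)
  have finX: "finite X"
  proof (rule finite_subset)
    show "X \<subseteq> {(r, \<sigma>) \<in> index_seqs m \<times> R. Poly_Mapping.keys (mono_of m (adj G l) r \<sigma>) \<subseteq> pairs n}"
      using XD(1,2,4) unfolding a_def by blast
    show "finite \<dots>"
      using Rperm by (intro finite_summands_bounded[OF G False lab(1) m_def] finite_pairs) auto
  qed
  have "bij_betw \<Phi> X (copies G H)"
  proof (rule bij_betwI')
    fix x y assume "x \<in> X" "y \<in> X"
    moreover obtain r \<sigma> r' \<sigma>' where xy: "x = (r, \<sigma>)" "y = (r', \<sigma>')" by (metis surj_pair)
    ultimately have X: "(r, \<sigma>) \<in> X" "(r', \<sigma>') \<in> X" by simp_all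
    note D = XD[OF X(1)] and D' = XD[OF X(2)]
    have "x = y" if eq: "\<Phi> x = \<Phi> y"
    proof -
      \<comment> \<open>An unordered edge gives back its ordered pair of labels, so equal edge sets
        come from equal supports.\<close>
      have "inj_on (\<lambda>(i, j). {h i, h j}) (pairs n)"
      proof (rule inj_onI, clarify)
        fix i j i' j' assume p: "(i, j) \<in> pairs n" "(i', j') \<in> pairs n"
          and "{h i, h j} = {h i', h j'}"
        then have "h ` {i, j} = h ` {i', j'}" by simp
        then have "{i, j} = {i', j'}"
          using inj_on_image_eq_iff[of h "{1..n}" "{i, j}" "{i', j'}"] h p
          by (auto simp: bij_betw_def pairs_def)
        then show "i = i' \<and> j = j'" using p by (auto simp: pairs_def doubleton_eq_iff)
      qed
      then have keq: "Poly_Mapping.keys (mono_of m a r \<sigma>) = Poly_Mapping.keys (mono_of m a r' \<sigma>')"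
        using eq D(4) D'(4) unfolding xy \<Phi>_def by (simp add: inj_on_image_eq_iff)
      have sm: "strict_mono_on {1..m} r" "strict_mono_on {1..m} r'"
        using D(1) D'(1) by (auto simp: index_seqs_def)
      have rimg: "r ` {1..m} = r' ` {1..m}" using range D(3) D'(3) keq by metis
      have "r = r'"
        by (rule extensionalityI[of _ "{1..m}"])
          (use D(1) D'(1) strict_mono_on_eqI[OF sm rimg] in \<open>auto simp: index_seqs_def\<close>)
      have inj: "inj_on r {1..m}" using sm(1) by (rule strict_mono_on_imp_inj_on)
      have mem: "{l (\<tau> i), l (\<tau> j)} \<in> edges G \<longleftrightarrow> (r i, r j) \<in> Poly_Mapping.keys (mono_of m a r \<tau>)"
        if "(i, j) \<in> pairs m" "\<tau> permutes {1..m}" for i j \<tau>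
        unfolding keys[OF that(2)] using that(1) inj by (auto simp: pairs_def inj_on_eq_iff)
      \<comment> \<open>The exponents are 0 or 1 and \<open>r\<close> is injective, so the support
        fixes all of them; a transversal contains one permutation per family.\<close>
      have "family m a \<sigma> = family m a \<sigma>'"
        unfolding family_def
        by (rule restrict_ext)
          (use a mem D(3) D'(3) keq \<open>r = r'\<close> in auto)
      then have "\<sigma> = \<sigma>'" using R D(2) D'(2) by (auto simp: transversal_def dest: inj_onD)
      then show ?thesis using \<open>r = r'\<close> xy by simp
    qed
    then show "\<Phi> x = \<Phi> y \<longleftrightarrow> x = y" by blast
  next
    fix x assume "x \<in> X"
    moreover obtain r \<sigma> where x: "x = (r, \<sigma>)" by (metis surj_pair)
    ultimately have X: "(r, \<sigma>) \<in> X" by simp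
    note D = XD[OF X]
    have k: "bij_betw (l \<circ> \<sigma>) {1..m} (verts G)"
      using permutes_imp_bij[OF D(3)] l by (rule bij_betw_trans)
    \<comment> \<open>Chosen so that \<open>g (l (\<sigma> i)) = h (r i)\<close>.\<close>
    define g where "g = h \<circ> r \<circ> inv_into {1..m} (l \<circ> \<sigma>)"
    have "r ` {1..m} \<subseteq> {1..n}"
      using range[OF D(3), of r] D(4) by (auto simp: pairs_def)
    moreover have "inj_on r {1..m}"
      using D(1) by (auto simp: index_seqs_def intro: strict_mono_on_imp_inj_on)
    ultimately have "inj_on (h \<circ> r) {1..m}"
      using h by (meson bij_betw_def comp_inj_on inj_on_subset)
    then have "inj_on g (verts G)"
      unfolding g_def using bij_betw_inv_into[OF k] by (metis bij_betw_def comp_inj_on)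
    moreover have "\<Phi> (r, \<sigma>) = (`) g ` edges G"
    proof (rule \<Phi>[OF D(3)])
      fix i assume i: "i \<in> {1..m}"
      have "inv_into {1..m} (l \<circ> \<sigma>) ((l \<circ> \<sigma>) i) = i"
        using k i by (intro inv_into_f_f) (auto simp: bij_betw_def)
      then show "g (l (\<sigma> i)) = h (r i)" by (simp add: g_def)
    qed
    ultimately show "\<Phi> x \<in> copies G H" using D(5) x by (auto simp: copies_def)
  next
    fix S assume "S \<in> copies G H"
    then obtain g where S: "S \<subseteq> edges H" and g: "inj_on g (verts G)" "S = (`) g ` edges G"
      by (auto simp: copies_def)
    have gv: "g ` verts G \<subseteq> verts H"
      using copies_image_verts[OF H G(2) False] S g(2) by simp
    \<comment> \<open>The labels of the vertices of the copy; \<open>r\<close> will list them in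
      increasing order.\<close>
    define Q where "Q = inv_into {1..n} h ` g ` verts G"
    have hinv: "bij_betw (inv_into {1..n} h) (verts H) {1..n}" using h by (rule bij_betw_inv_into)
    have Q1: "Q \<subseteq> {1..n}" unfolding Q_def using hinv gv by (auto simp: bij_betw_def)
    have "inj_on (inv_into {1..n} h) (g ` verts G)"
      using hinv gv by (meson bij_betw_def inj_on_subset)
    then have cQ: "card Q = m" unfolding Q_def m_def by (simp add: card_image g(1))
    have hQ: "h ` Q = g ` verts G"
      unfolding Q_def using h gv by (simp add: bij_betw_def image_inv_into_cancel)
    obtain r where r: "r \<in> index_seqs m" "r ` {1..m} = Q"
      by (rule index_seqs_exists[of Q m]) (use Q1 cQ in \<open>auto intro: finite_subset\<close>)
    have rinj: "inj_on r {1..m}"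
      using r(1) by (auto simp: index_seqs_def intro: strict_mono_on_imp_inj_on)
    \<comment> \<open>Position \<open>i\<close> goes to the label in \<open>G\<close> of the vertex
      that \<open>g\<close> maps to \<open>h (r i)\<close>.\<close>
    define f where "f = inv_into {1..m} l \<circ> (inv_into (verts G) g \<circ> (h \<circ> r))"
    have "bij_betw r {1..m} Q" using rinj r(2) by (simp add: bij_betw_def)
    moreover have "bij_betw h Q (g ` verts G)"
      using h Q1 hQ by (auto simp: bij_betw_def intro: inj_on_subset)
    moreover have "bij_betw (inv_into (verts G) g) (g ` verts G) (verts G)"
      using g(1) by (intro bij_betw_inv_into) (simp add: bij_betw_def)
    ultimately have f: "bij_betw f {1..m} {1..m}"
      unfolding f_def using bij_betw_inv_into[OF l] by (blast intro: bij_betw_trans)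
    define \<sigma> where "\<sigma> = (\<lambda>i. if i \<in> {1..m} then f i else i)"
    have \<sigma>: "\<sigma> permutes {1..m}"
      by (rule bij_imp_permutes)
        (use f bij_betw_cong[of "{1..m}" \<sigma> f] in \<open>auto simp: \<sigma>_def\<close>)
    have g\<sigma>: "g (l (\<sigma> i)) = h (r i)" if i: "i \<in> {1..m}" for i
    proof -
      have hr: "h (r i) \<in> g ` verts G" using r(2) hQ i by blast
      then have "inv_into (verts G) g (h (r i)) \<in> verts G" by (rule inv_into_into)
      then have "l (f i) = inv_into (verts G) g (h (r i))"
        unfolding f_def using l by (simp add: bij_betw_def f_inv_into_f)
      then show ?thesis using i hr by (simp add: \<sigma>_def f_inv_into_f)
    qed
    have \<Phi>S: "\<Phi> (r, \<sigma>) = S" using \<Phi>[where g = g and r = r, OF \<sigma> g\<sigma>] g(2) by simp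
    \<comment> \<open>\<open>\<sigma>\<close> need not lie in \<open>R\<close>; its representative
      has the same exponents and hence the same support.\<close>
    obtain \<tau> where \<tau>: "\<tau> \<in> R" "family m a \<tau> = family m a \<sigma>"
      using R \<sigma> unfolding transversal_def by (metis (mono_tags, lifting) imageE image_eqI mem_Collect_eq)
    have "a (act \<tau> p) = a (act \<sigma> p)" if "p \<in> pairs m" for p
      using fun_cong[OF \<tau>(2), of p] that by (simp add: family_def)
    then have keq: "Poly_Mapping.keys (mono_of m a r \<tau>) = Poly_Mapping.keys (mono_of m a r \<sigma>)"
      unfolding keys_mono_of by (metis (no_types, lifting))
    then have "\<Phi> (r, \<tau>) = S" using \<Phi>S by (simp add: \<Phi>_def)
    moreover have "(r, \<tau>) \<in> X"
    proof -
      have "adj H h p = (1 :: nat)" if p: "p \<in> Poly_Mapping.keys (mono_of m a r \<sigma>)" for p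
      proof -
        obtain i j where ij: "p = (r i, r j)" "(i, j) \<in> pairs m"
          using p unfolding keys[OF \<sigma>] by blast
        have "r i < r j"
          using r(1) ij(2) strict_mono_onD[of "{1..m}" r i j] by (auto simp: index_seqs_def pairs_def)
        moreover have "i \<in> {1..m}" "j \<in> {1..m}" using ij(2) by (auto simp: pairs_def)
        then have "r i \<in> {1..n}" "r j \<in> {1..n}" using r(2) Q1 by blast+
        moreover have "{h (r i), h (r j)} \<in> \<Phi> (r, \<sigma>)"
          unfolding \<Phi>_def using p ij(1) by force
        ultimately show ?thesis using \<Phi>S S ij(1) adjH by (auto simp: pairs_def)
      qed
      then show ?thesis using keq r(1) \<tau>(1) by (auto simp: X_def)
    qed
    ultimately show "\<exists>x\<in>X. S = \<Phi> x" by blast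
  qed
  then have card: "card X = card (copies G H)" by (rule bij_betw_same_card)
  have "M_graph G = (series_of m a R :: 'k series)"
    using False by (simp add: M_graph_def m_def a_def l_def R_def Let_def)
  then have "M_at G H = (eval_series (adj H h) (series_of m a R) :: 'k)"
    by (simp add: M_at_def h_def)
  also have "\<dots> = of_nat (card X)"
    unfolding X_def using finX by (subst adj_of_bool, subst eval_series_of) (simp_all add: X_def)
  finally show ?thesis using card by simp
qed

section \<open>Counting permutations by their action on edges\<close>

lemma permutes_inj_image: "\<pi> permutes V \<Longrightarrow> inj ((`) \<pi>)"
  using inj_on_image_Pow[of \<pi> UNIV] permutes_inj[of \<pi> V] by simp

text \<open>The complements of \<open>U\<close> and of its image have equal size, so any bijection
  between them completes \<open>g\<close>. This links copies, given by injections, to counts of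
  permutations.\<close>

lemma permutes_extend:
  assumes V: "finite V" "U \<subseteq> V" and g: "inj_on g U" "g ` U \<subseteq> V"
  obtains \<pi> where "\<pi> permutes V" "\<And>x. x \<in> U \<Longrightarrow> \<pi> x = g x"
proof -
  have fU: "finite U" using V finite_subset by blast
  have "card (V - U) = card (V - g ` U)"
    using V g by (simp add: card_Diff_subset fU card_image)
  then obtain f where f: "bij_betw f (V - U) (V - g ` U)"
    using V(1) finite_same_card_bij by blast
  define \<pi> where "\<pi> = (\<lambda>x. if x \<in> U then g x else if x \<in> V then f x else x)"
  have "bij_betw \<pi> U (g ` U)"
    using g(1) by (subst bij_betw_cong[of _ _ g]) (auto simp: \<pi>_def bij_betw_def)
  moreover have "bij_betw \<pi> (V - U) (V - g ` U)"
    using f by (subst bij_betw_cong[of _ _ f]) (auto simp: \<pi>_def)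
  ultimately have "bij_betw \<pi> (U \<union> (V - U)) (g ` U \<union> (V - g ` U))"
    by (rule bij_betw_combine) auto
  moreover have "U \<union> (V - U) = V" "g ` U \<union> (V - g ` U) = V" using V g by auto
  ultimately have "\<pi> permutes V"
    using V by (intro bij_imp_permutes) (auto simp: \<pi>_def)
  then show thesis using that by (simp add: \<pi>_def)
qed

text \<open>The set whose cardinality is N(A, B) in the overview, with \<open>E\<close> the edge set
  of the host graph.\<close>

definition placements :: "'a set \<Rightarrow> 'a set set \<Rightarrow> 'a set set \<Rightarrow> 'a set set \<Rightarrow> ('a \<Rightarrow> 'a) set" where
  "placements V A B E = {\<pi>. \<pi> permutes V \<and> (`) \<pi> ` A \<subseteq> E \<and> (`) \<pi> ` B \<inter> E = {}}"

lemma finite_placements: "finite V \<Longrightarrow> finite (placements V A B E)"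
  by (rule finite_subset[OF _ finite_permutations]) (auto simp: placements_def)

text \<open>The image of \<open>e\<close> is either in \<open>E\<close> or not. The additive form
  avoids subtraction of natural numbers.\<close>

lemma card_placements_insert:
  assumes "finite V"
  shows "card (placements V A (insert e B) E) + card (placements V (insert e A) B E) =
    card (placements V A B E)"
proof -
  have "placements V A B E = placements V A (insert e B) E \<union> placements V (insert e A) B E"
    by (auto simp: placements_def)
  moreover have "placements V A (insert e B) E \<inter> placements V (insert e A) B E = {}"
    by (auto simp: placements_def)
  ultimately show ?thesis by (simp add: card_Un_disjoint finite_placements assms)
qed

text \<open>Orbit-stabilizer: placements are sorted by the image \<open>S\<close> of
  \<open>A\<close>, and each nonempty fiber is a coset of the stabilizer. The stabilizer factor does
  not depend on \<open>E\<close>, so counts of images determine counts of placements.\<close>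

lemma card_placements_orbit:
  assumes V: "finite V" and E: "finite E"
  shows "card (placements V A {} E) =
    card {S. S \<subseteq> E \<and> (\<exists>\<pi>. \<pi> permutes V \<and> S = (`) \<pi> ` A)} * card {\<pi>. \<pi> permutes V \<and> (`) \<pi> ` A = A}"
    (is "_ = card ?O * card ?Stab")
proof -
  have "placements V A {} E = (\<Union>S\<in>?O. {\<pi>. \<pi> permutes V \<and> (`) \<pi> ` A = S})"
    by (auto simp: placements_def)
  also have "card \<dots> = (\<Sum>S\<in>?O. card {\<pi>. \<pi> permutes V \<and> (`) \<pi> ` A = S})"
  proof (rule card_UN_disjoint)
    show "finite ?O" using E by (intro finite_subset[of ?O "Pow E"]) auto
    show "\<forall>S\<in>?O. finite {\<pi>. \<pi> permutes V \<and> (`) \<pi> ` A = S}"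
      using finite_permutations[OF V] by auto
    show "\<forall>S\<in>?O. \<forall>T\<in>?O. S \<noteq> T \<longrightarrow>
        {\<pi>. \<pi> permutes V \<and> (`) \<pi> ` A = S} \<inter> {\<pi>. \<pi> permutes V \<and> (`) \<pi> ` A = T} = {}"
      by blast
  qed
  also have "\<dots> = (\<Sum>S\<in>?O. card ?Stab)"
  proof (rule sum.cong[OF refl])
    fix S assume "S \<in> ?O"
    then obtain \<tau> where \<tau>: "\<tau> permutes V" "S = (`) \<tau> ` A" by blast
    have img: "(`) (\<tau> \<circ> \<pi>) ` A = (`) \<tau> ` (`) \<pi> ` A" for \<pi> :: "'a \<Rightarrow> 'a"
      by (simp add: image_image image_comp)
    \<comment> \<open>Composition with \<open>\<tau>\<close> is undone by composition with
      \<open>inv \<tau>\<close>.\<close>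
    have "bij_betw ((\<circ>) \<tau>) ?Stab {\<pi>. \<pi> permutes V \<and> (`) \<pi> ` A = S}"
    proof (rule bij_betw_imageI)
      show "inj_on ((\<circ>) \<tau>) ?Stab"
        using fun.inj_map[OF permutes_inj[OF \<tau>(1)]] by (rule inj_on_subset) simp
      show "(\<circ>) \<tau> ` ?Stab = {\<pi>. \<pi> permutes V \<and> (`) \<pi> ` A = S}"
      proof (intro equalityI subsetI)
        fix \<rho> assume "\<rho> \<in> (\<circ>) \<tau> ` ?Stab"
        then obtain \<pi> where "\<pi> permutes V" "(`) \<pi> ` A = A" "\<rho> = \<tau> \<circ> \<pi>" by blast
        then show "\<rho> \<in> {\<pi>. \<pi> permutes V \<and> (`) \<pi> ` A = S}"
          using img[of \<pi>] \<tau> permutes_compose by auto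
      next
        fix \<rho> assume "\<rho> \<in> {\<pi>. \<pi> permutes V \<and> (`) \<pi> ` A = S}"
        then have \<rho>: "\<rho> permutes V" "(`) \<rho> ` A = S" by auto
        have eq: "\<rho> = \<tau> \<circ> (inv \<tau> \<circ> \<rho>)"
          by (simp add: fun_eq_iff permutes_inverses(1)[OF \<tau>(1)])
        moreover have "inv \<tau> \<circ> \<rho> permutes V"
          using \<rho>(1) permutes_inv[OF \<tau>(1)] by (rule permutes_compose)
        moreover have "(`) \<tau> ` (`) (inv \<tau> \<circ> \<rho>) ` A = (`) \<tau> ` A"
          using img[of "inv \<tau> \<circ> \<rho>"] eq \<rho>(2) \<tau>(2) by simp
        then have "(`) (inv \<tau> \<circ> \<rho>) ` A = A"
          using permutes_inj_image[OF \<tau>(1)] by (simp only: inj_image_eq_iff)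
        ultimately show "\<rho> \<in> (\<circ>) \<tau> ` ?Stab" by blast
      qed
    qed
    then show "card {\<pi>. \<pi> permutes V \<and> (`) \<pi> ` A = S} = card ?Stab"
      by (simp add: bij_betw_same_card)
  qed
  finally show ?thesis by simp
qed

text \<open>Taking \<open>\<Union>A\<close> as vertex set leaves no vertex isolated. An injection of
  it that sends \<open>A\<close> into the edges of \<open>H\<close> stays inside
  \<open>verts H\<close> and extends to a permutation.\<close>

lemma copies_eq_orbit:
  assumes H: "simple_graph H" and A: "\<Union>A \<subseteq> verts H"
  shows "copies \<lparr>verts = \<Union>A, edges = A\<rparr> H =
    {S. S \<subseteq> edges H \<and> (\<exists>\<pi>. \<pi> permutes verts H \<and> S = (`) \<pi> ` A)}"
proof (intro equalityI subsetI)
  fix S assume "S \<in> copies \<lparr>verts = \<Union>A, edges = A\<rparr> H"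
  then obtain g where S: "S \<subseteq> edges H" and g: "inj_on g (\<Union>A)" "S = (`) g ` A"
    by (auto simp: copies_def)
  have "g ` \<Union>A \<subseteq> verts H"
    using S g(2) H by (auto simp: simple_graph_def)
  then obtain \<pi> where \<pi>: "\<pi> permutes verts H" "\<And>x. x \<in> \<Union>A \<Longrightarrow> \<pi> x = g x"
    using permutes_extend[OF _ A g(1)] H unfolding simple_graph_def by blast
  have "(`) \<pi> ` A = (`) g ` A"
    by (intro image_cong refl) (use \<pi>(2) in blast)
  then have "S = (`) \<pi> ` A" using g(2) by simp
  then show "S \<in> {S. S \<subseteq> edges H \<and> (\<exists>\<pi>. \<pi> permutes verts H \<and> S = (`) \<pi> ` A)}"
    using S \<pi>(1) by blast
next
  fix S assume "S \<in> {S. S \<subseteq> edges H \<and> (\<exists>\<pi>. \<pi> permutes verts H \<and> S = (`) \<pi> ` A)}"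
  then show "S \<in> copies \<lparr>verts = \<Union>A, edges = A\<rparr> H"
    by (auto simp: copies_def intro: permutes_inj_on)
qed

section \<open>Reconstruction from the counts of small subgraphs\<close>

text \<open>An injective image of the edges inside a finite set of the same size is the whole
  set.\<close>

lemma isomorphic_if_permutes:
  assumes "simple_graph G" "simple_graph H" "verts G = verts H"
    and "\<pi> permutes verts H" "(`) \<pi> ` edges G \<subseteq> edges H" "card (edges G) = card (edges H)"
  shows "isomorphic G H"
proof -
  have "card ((`) \<pi> ` edges G) = card (edges G)"
    by (intro card_image inj_on_subset[OF permutes_inj_image[OF assms(4)]]) simp
  then have "(`) \<pi> ` edges G = edges H"
    using assms(2,5,6) by (simp add: card_subset_eq simple_graph_finite_edges)
  moreover have "bij_betw \<pi> (verts G) (verts H)"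
    using permutes_imp_bij[OF assms(4)] assms(3) by simp
  ultimately show ?thesis using isomorphic_iff_image[OF assms(1,2)] by blast
qed

lemma isomorphic_if_copies_eq:
  fixes H1 H2 :: "'a sgraph"
  assumes H: "simple_graph H1" "simple_graph H2" "verts H1 = V" "verts H2 = V"
    and card: "card (edges H1) = card (edges H2)"
    and copies: "\<And>G :: 'a sgraph. simple_graph G \<Longrightarrow> no_isolated_vertex G \<Longrightarrow>
      card (verts G) \<le> card V \<Longrightarrow> card (edges G) \<le> (card V choose 2) div 2 \<Longrightarrow>
      card (copies G H1) = card (copies G H2)"
  shows "isomorphic H1 H2"
proof -
  define K where "K = {e. e \<subseteq> V \<and> card e = 2}"
  define M where "M = (card V choose 2) div 2"
  have V: "finite V" using H by (auto simp: simple_graph_def)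
  have E: "edges H1 \<subseteq> K" "edges H2 \<subseteq> K" using H by (auto simp: simple_graph_def K_def)
  have finK: "finite K" using V by (auto simp: K_def intro: finite_subset[of _ "Pow V"])
  have cardK: "card K = card V choose 2" unfolding K_def by (rule n_subsets[OF V])
  have base: "card (placements V A {} (edges H1)) = card (placements V A {} (edges H2))"
    if A: "A \<subseteq> K" "card A \<le> M" for A
  \<comment> \<open>The empty set is separate because \<open>\<Union>A\<close> would give a graph
    without vertices; in that case both sides count all permutations of \<open>V\<close>.\<close>
  proof (cases "A = {}")
    case False
    let ?G = "\<lparr>verts = \<Union>A, edges = A\<rparr>"
    have UA: "\<Union>A \<subseteq> V" using A(1) by (auto simp: K_def)
    have "{} \<notin> K" by (simp add: K_def)
    then have "\<Union>A \<noteq> {}" using False A(1) by (metis Union_empty_conv equals0I subsetD)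
    then have "simple_graph ?G"
      using UA A(1) finite_subset[OF UA V] by (auto simp: simple_graph_def K_def)
    moreover have "no_isolated_vertex ?G" by (auto simp: no_isolated_vertex_def)
    moreover have "card (verts ?G) \<le> card V" using UA V by (simp add: card_mono)
    ultimately have "card (copies ?G H1) = card (copies ?G H2)"
      using copies A(2) by (simp add: M_def)
    then show ?thesis
      using copies_eq_orbit[OF H(1), of A] copies_eq_orbit[OF H(2), of A] UA H(3,4)
      by (simp add: card_placements_orbit V simple_graph_finite_edges H)
  qed (simp add: placements_def)
  have main: "card (placements V A B (edges H1)) = card (placements V A B (edges H2))"
    if "A \<subseteq> K" "B \<subseteq> K" "card A + card B \<le> M" for A B
  proof -
    have "finite B" using that(2) finK finite_subset by blast
    then show ?thesis using that
    \<comment> \<open>\<open>A\<close> must vary: an element leaving \<open>B\<close> may join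
      \<open>A\<close>, which keeps the total size within the bound.\<close>
    proof (induction B arbitrary: A)
      case empty
      then show ?case using base by simp
    next
      case (insert e B)
      have "card (insert e A) \<le> Suc (card A)" by (rule card_insert_le_m1) simp_all
      then have "card (placements V (insert e A) B (edges H1)) = card (placements V (insert e A) B (edges H2))"
        using insert by (intro insert.IH) auto
      moreover have "card (placements V A B (edges H1)) = card (placements V A B (edges H2))"
        using insert by (intro insert.IH) auto
      ultimately show ?case
        using card_placements_insert[OF V, of A e B "edges H1"]
          card_placements_insert[OF V, of A e B "edges H2"] by simp
    qed
  qed
  have ex: "\<exists>\<pi>. \<pi> \<in> placements V A B (edges H2)"
    if "A \<subseteq> edges H1" "B \<inter> edges H1 = {}" "B \<subseteq> K" "card A + card B \<le> M" for A B
  proof -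
    \<comment> \<open>The identity makes the count for \<open>H1\<close> nonzero, and equality of
      counts yields a placement for \<open>H2\<close>.\<close>
    have "id \<in> placements V A B (edges H1)"
      using that by (auto simp: placements_def permutes_id)
    then have "card (placements V A B (edges H1)) \<noteq> 0"
      using finite_placements[OF V] by (metis card_0_eq empty_iff)
    then have "card (placements V A B (edges H2)) \<noteq> 0" using main[of A B] that E by auto
    then show ?thesis by (metis all_not_in_conv card.empty)
  qed
  show ?thesis
  proof (cases "card (edges H1) \<le> M")
    case True
    obtain \<pi> where "\<pi> \<in> placements V (edges H1) {} (edges H2)"
      using ex[of "edges H1" "{}"] True by auto
    then show ?thesis
      using isomorphic_if_permutes[of H1 H2 \<pi>] H card by (auto simp: placements_def)
  next
    case False
    have "card (K - edges H1) = card K - card (edges H1)"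
      using E(1) H(1) by (simp add: card_Diff_subset simple_graph_finite_edges)
    \<comment> \<open>\<open>K\<close> has at most \<open>2 * M + 1\<close> elements, and at least
      \<open>M + 1\<close> of them are edges of \<open>H1\<close>.\<close>
    then have "card (K - edges H1) \<le> M" using False cardK by (simp add: M_def)
    then obtain \<pi> where \<pi>: "\<pi> \<in> placements V {} (K - edges H1) (edges H2)"
      using ex[of "{}" "K - edges H1"] by auto
    then have p: "\<pi> permutes V" "inv \<pi> permutes V" by (auto simp: placements_def permutes_inv)
    \<comment> \<open>\<open>\<pi>\<close> takes non-edges of \<open>H1\<close> to non-edges of
      \<open>H2\<close>; by contraposition its inverse takes edges of \<open>H2\<close> to edges of
      \<open>H1\<close>.\<close>
    have "(`) (inv \<pi>) ` edges H2 \<subseteq> edges H1"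
    proof
      fix x assume "x \<in> (`) (inv \<pi>) ` edges H2"
      then obtain y where y: "y \<in> edges H2" "x = inv \<pi> ` y" by blast
      have "\<pi> ` x = y"
        using y(2) by (simp add: image_image permutes_inverses(1)[OF p(1)])
      moreover have "x \<in> K"
      proof -
        have "y \<subseteq> V" "card y = 2" using y(1) E(2) by (auto simp: K_def)
        then have "inv \<pi> ` y \<subseteq> V" using permutes_image[OF p(2)] by blast
        moreover have "card (inv \<pi> ` y) = 2"
          using \<open>card y = 2\<close> by (simp add: card_image permutes_inj_on[OF p(2)])
        ultimately show ?thesis using y(2) by (simp add: K_def)
      qed
      ultimately show "x \<in> edges H1" using \<pi> y(1) by (auto simp: placements_def)
    qed
    then have "isomorphic H2 H1"
      using isomorphic_if_permutes[of H2 H1 "inv \<pi>"] H card p by simp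
    then show ?thesis by (rule isomorphic_sym)
  qed
qed

text \<open>Recovers the number of edges from a subgraph count: the copies of a single edge are the
  singletons of edges.\<close>

lemma card_copies_edge:
  assumes "simple_graph H" "u \<noteq> v"
  shows "card (copies \<lparr>verts = {u, v}, edges = {{u, v}}\<rparr> H) = card (edges H)"
proof -
  have "copies \<lparr>verts = {u, v}, edges = {{u, v}}\<rparr> H = (\<lambda>e. {e}) ` edges H"
  proof (intro equalityI subsetI)
    fix S assume "S \<in> (\<lambda>e. {e}) ` edges H"
    then obtain e where e: "e \<in> edges H" "S = {e}" by blast
    obtain x y where xy: "e = {x, y}" "x \<noteq> y"
      using simple_graph_edgeE[OF assms(1) e(1)] by metis
    define g where "g = (\<lambda>w. if w = u then x else y)"
    have "g u = x" "g v = y" using assms(2) by (auto simp: g_def)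
    then have "inj_on g {u, v}" "S = (`) g ` {{u, v}}"
      using xy e(2) by (auto simp: inj_on_def)
    then show "S \<in> copies \<lparr>verts = {u, v}, edges = {{u, v}}\<rparr> H"
      using e unfolding copies_def by (intro CollectI conjI exI[of _ g]) auto
  qed (auto simp: copies_def)
  then show ?thesis by (simp add: card_image)
qed

text \<open>The test graphs of the theorem have natural numbers as vertices. Moving both graphs to
  \<open>{1..n}\<close> gives them a common vertex set and makes graphs formed from its pairs
  available as test graphs.\<close>

lemma isomorphic_relabel:
  assumes "simple_graph H"
  obtains K :: "nat sgraph" where "simple_graph K" "verts K = {1..card (verts H)}" "isomorphic H K"
proof -
  obtain l where l: "bij_betw l (verts H) {1..card (verts H)}"
    using finite_same_card_bij[of "verts H" "{1..card (verts H)}"] assms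
    by (auto simp: simple_graph_def)
  let ?K = "\<lparr>verts = {1..card (verts H)}, edges = (`) l ` edges H\<rparr>"
  have "l ` e \<subseteq> {1..card (verts H)} \<and> card (l ` e) = 2" if "e \<in> edges H" for e
  proof -
    have e: "e \<subseteq> verts H" "card e = 2" using that assms by (auto simp: simple_graph_def)
    have "inj_on l e" using l e(1) by (meson bij_betw_def inj_on_subset)
    then have "card (l ` e) = 2" using e(2) by (simp add: card_image)
    moreover have "l ` e \<subseteq> {1..card (verts H)}" using e(1) l unfolding bij_betw_def by blast
    ultimately show ?thesis by simp
  qed
  then have K: "simple_graph ?K"
    using assms by (auto simp: simple_graph_def Suc_le_eq card_gt_0_iff)
  moreover have "isomorphic H ?K"
    using l isomorphic_iff_image[OF assms K] by auto
  ultimately show thesis using that by simp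
qed

theorem theorem4p5:
  fixes H1 :: "'a sgraph" and H2 :: "'b sgraph" and n :: nat
  assumes "n \<ge> 1" and "n \<noteq> 2"
    and "simple_graph H1" and "card (verts H1) = n"
    and "simple_graph H2" and "card (verts H2) = n"
  shows "(isomorphic H1 H2 \<longleftrightarrow>
           (\<forall>G :: nat sgraph. simple_graph G \<and> no_isolated_vertex G \<and> card (verts G) \<le> n \<and>
              card (edges G) \<le> (n choose 2) div 2 \<longrightarrow>
              (P_at n G H1 :: 'k::field_char_0) = P_at n G H2)) \<and>
         (isomorphic H1 H2 \<longleftrightarrow>
           (\<forall>G :: nat sgraph. simple_graph G \<and> no_isolated_vertex G \<and> card (verts G) \<le> n \<and>
              card (edges G) \<le> (n choose 2) div 2 \<longrightarrow>
              (M_at G H1 :: 'k::field_char_0) = M_at G H2))"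
proof -
  note H = assms(3,5) and n = assms(4,6)
  have M: "(M_at G H1 :: 'k) = M_at G H2 \<longleftrightarrow> card (copies G H1) = card (copies G H2)"
    if "simple_graph G" "no_isolated_vertex G" for G :: "nat sgraph"
    by (simp add: M_at_eq_card_copies[OF that] H)
  have P: "(P_at n G H1 :: 'k) = P_at n G H2 \<longleftrightarrow> card (copies G H1) = card (copies G H2)"
    if "simple_graph G" "no_isolated_vertex G" for G :: "nat sgraph"
    using M[OF that] by (simp add: P_at_eq_M_at[OF that] n)
  have "isomorphic H1 H2 \<longleftrightarrow>
      (\<forall>G :: nat sgraph. simple_graph G \<and> no_isolated_vertex G \<and> card (verts G) \<le> n \<and>
        card (edges G) \<le> (n choose 2) div 2 \<longrightarrow> card (copies G H1) = card (copies G H2))"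
    (is "_ \<longleftrightarrow> ?R")
  proof
    assume "isomorphic H1 H2"
    then show ?R using card_copies_isomorphic H by blast
  next
    assume R: ?R
    obtain K1 :: "nat sgraph" where K1: "simple_graph K1" "verts K1 = {1..n}" "isomorphic H1 K1"
      using isomorphic_relabel[OF H(1)] n by metis
    obtain K2 :: "nat sgraph" where K2: "simple_graph K2" "verts K2 = {1..n}" "isomorphic H2 K2"
      using isomorphic_relabel[OF H(2)] n by metis
    have copies: "card (copies G K1) = card (copies G K2)"
      if G: "simple_graph G" "no_isolated_vertex G" "card (verts G) \<le> n"
        "card (edges G) \<le> (n choose 2) div 2" for G :: "nat sgraph"
      using R G card_copies_isomorphic[OF G(1,2) H(1) K1(1,3)]
        card_copies_isomorphic[OF G(1,2) H(2) K2(1,3)] by simp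
    have "card (edges K1) = card (edges K2)"
    proof (cases "n = 1")
      case True
      then show ?thesis
        using simple_graph_one_vertex[OF K1(1)] simple_graph_one_vertex[OF K2(1)] K1(2) K2(2) by simp
    next
      case False
      then have n3: "n \<ge> 3" using assms(1,2) by simp
      \<comment> \<open>From three vertices on the bound on edges is at least 1, so the single edge
        is an admissible test graph.\<close>
      then have "3 * 2 \<le> n * (n - 1)" by (intro mult_le_mono) auto
      then have "1 \<le> (n choose 2) div 2" unfolding choose_two by simp
      then show ?thesis
        using copies[of "\<lparr>verts = {1, 2}, edges = {{1, 2}}\<rparr>"] n3
          card_copies_edge[OF K1(1), of 1 "2 :: nat"]
          card_copies_edge[OF K2(1), of 1 "2 :: nat"]
        by (simp add: simple_graph_def no_isolated_vertex_def)
    qed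
    then have "isomorphic K1 K2"
      by (intro isomorphic_if_copies_eq[of K1 K2 "{1..n}"] K1 K2) (simp_all add: copies)
    then show "isomorphic H1 H2"
      using K1(3) isomorphic_sym[OF K2(3)] by (blast intro: isomorphic_trans)
  qed
  \<comment> \<open>\<open>imp_cong\<close> makes the premises on \<open>G\<close> available for the
    conditional rewriting by \<open>M\<close> and \<open>P\<close>.\<close>
  then show ?thesis by (simp add: M P cong: imp_cong)
qed

end
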